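(* The discrete initial value problem $$n\,\triangle f(n) = 1 \quad \text{for integers } n\geq 2, \qquad f(2) = 2,$$ for an unknown real-valued sequence $f(n)$, $n\ge 2$, has solution given by $$f(n) = 1+\sum_{k=1}^{n-1}\frac{1}{k} \quad (n\geq 2).$$
   Context: For a real-valued sequence $f$, the first order difference is defined by $\triangle f(n) := f(n+1)-f(n)$. *)

theory Defs
  imports Complex_Main
begin

definition fwd_diff :: "(nat \<Rightarrow> real) \<Rightarrow> nat \<Rightarrow> real" where
  "fwd_diff f n = f (n + 1) - f n"

(* A sequence indexed by n >= 2 is represented by a total function on nat whose
   values at 0 and 1 are irrelevant: the predicate does not constrain them. *)
definition solves_ivp :: "(nat \<Rightarrow> real) \<Rightarrow> bool" where
  "solves_ivp f \<longleftrightarrow> (\<forall>n\<ge>2. real n * fwd_diff f n = 1) \<and> f 2 = 2"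

end

theory Submission imports Defs
begin

text \<open>
  For \<open>n \<ge> 2\<close> the equation \<open>n \<triangle>f(n) = 1\<close> is the first-order recurrence
  \<open>f(n + 1) = f(n) + 1/n\<close>, so it determines \<open>f\<close> on \<open>n \<ge> 2\<close> from the value \<open>f(2)\<close>.
  The sequence \<open>1 + (\<Sum>k=1..n-1. 1/k)\<close> satisfies this recurrence, because its upper limit
  grows by one term \<open>1/n\<close>, and takes the value \<open>2\<close> at \<open>n = 2\<close>. Induction from \<open>2\<close>
  therefore gives uniqueness, and reading off one step gives existence.
\<close>

lemma sum_inverse_nat_step:
  fixes n :: nat
  assumes "n \<ge> 1"
  shows "(\<Sum>k=1..n. 1 / real k) = (\<Sum>k=1..n-1. 1 / real k) + 1 / real n"
  using assms by (cases n) simp_all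

theorem proposition4:
  fixes f :: "nat \<Rightarrow> real"
  shows "solves_ivp f \<longleftrightarrow> (\<forall>n\<ge>2. f n = 1 + (\<Sum>k=1..n-1. 1 / real k))"
proof
  assume "solves_ivp f"
  then have eq: "real n * (f (n + 1) - f n) = 1" if "n \<ge> 2" for n
    using that by (simp add: solves_ivp_def fwd_diff_def)
  have init: "f 2 = 2"
    using \<open>solves_ivp f\<close> by (simp add: solves_ivp_def)
  show "\<forall>n\<ge>2. f n = 1 + (\<Sum>k=1..n-1. 1 / real k)"
  proof (intro allI impI)
    fix n :: nat
    assume "n \<ge> 2"
    then show "f n = 1 + (\<Sum>k=1..n-1. 1 / real k)"
    proof (induction n rule: dec_induct)
      case base
      show ?case by (simp add: init)
    next
      case (step n)
      have "f (n + 1) = f n + 1 / real n"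
        using eq[of n] step.hyps by (simp add: field_simps)
      then show ?case
        using step sum_inverse_nat_step[of n] by simp
    qed
  qed
next
  assume closed: "\<forall>n\<ge>2. f n = 1 + (\<Sum>k=1..n-1. 1 / real k)"
  have "real n * fwd_diff f n = 1" if "n \<ge> 2" for n
  proof -
    have "fwd_diff f n = 1 / real n"
      using closed that sum_inverse_nat_step[of n] by (simp add: fwd_diff_def)
    then show ?thesis using that by simp
  qed
  moreover have "f 2 = 2" using closed by simp
  ultimately show "solves_ivp f" by (simp add: solves_ivp_def)
qed

end
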